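(* The set of all complex numbers $z$ such that $\mathrm{NRel}(G;z)=0$ for some finite simple graph $G$ is dense in $\mathbb{C}$.
   Context: For a finite simple undirected graph $G$ with $n$ nodes, a connected set of $G$ is a nonempty subset of nodes inducing a connected subgraph. Let $c_k$ be the number of connected sets of $G$ of order $k$. The node reliability polynomial of $G$ is $\mathrm{NRel}(G;p)=\sum_{k=1}^n c_k p^k(1-p)^{n-k}$, regarded as a polynomial in a complex variable $p$. *)

theory Defs
  imports
    "HOL-Analysis.Analysis"
    "HOL-Computational_Algebra.Polynomial"
    "Graph_Theory.Graph_Theory"
begin

text \<open>
  A finite simple undirected graph is a \<open>pair_graph\<close>: finitely many vertices, loop-free, and
  every undirected edge is represented by both of its orientations. The plain name
  \<open>connected\<close> is ambiguous between topology and graph theory, hence the qualification.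
\<close>

definition connected_sets :: "'a pair_pre_digraph \<Rightarrow> 'a set set" where
  "connected_sets G =
     {S. S \<subseteq> pverts G \<and> S \<noteq> {} \<and> Digraph_Component.connected (with_proj G \<restriction> S)}"

definition num_connected_sets :: "'a pair_pre_digraph \<Rightarrow> nat \<Rightarrow> nat" where
  "num_connected_sets G k = card {S \<in> connected_sets G. card S = k}"

definition NRel :: "'a pair_pre_digraph \<Rightarrow> complex poly" where
  "NRel G = (let n = card (pverts G) in
     \<Sum>k=1..n. smult (of_nat (num_connected_sets G k)) ([:0, 1:] ^ k * [:1, -1:] ^ (n - k)))"

text \<open>
  For the graph without vertices \<open>NRel\<close> is an empty sum, hence the zero polynomial, and every
  complex number would be a root; statements about roots must therefore require
  \<open>pverts G \<noteq> {}\<close>. Restricting the vertices to \<open>nat\<close> loses nothing, since every finite graph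
  is isomorphic to one on a finite set of naturals.
\<close>

end

theory Submission
  imports Defs "HOL-Complex_Analysis.Complex_Analysis"
begin

text \<open>
  In the variable \<open>t = p / (1 - p)\<close> the polynomial becomes, up to a power of \<open>1 - p\<close>, the generating
  function \<open>\<Sum> t\<^bsup>|S|\<^esup>\<close> of the connected sets. Hanging a star with \<open>K\<close> leaves on a vertex \<open>x\<close> by its
  centre multiplies the contribution of the connected sets through \<open>x\<close> by \<open>F = 1 + t (1 + t)\<^sup>K\<close>, and
  for \<open>t\<close> outside a nowhere dense set some \<open>K\<close> gives \<open>|F| > 1\<close>. Hanging \<open>l \<rightarrow> \<infinity>\<close> stars on \<open>u\<close> makes the
  connected sets avoiding \<open>u\<close> negligible, so by Hurwitz' theorem zeros of the generating function of
  the connected sets containing \<open>u\<close> are limits of zeros.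

  Take adjacent vertices \<open>u\<close>, \<open>v\<close>, hang \<open>m\<close> stars on \<open>v\<close>, and add \<open>n\<close> gadgets: a vertex \<open>a\<close> joined to
  \<open>u\<close>, \<open>v\<close> carrying \<open>k\<close> stars, and a vertex \<open>b\<close> joined to \<open>a\<close>, \<open>v\<close>. With \<open>\<alpha> = t F\<^sup>k\<close> the sets containing
  \<open>u\<close> contribute \<open>t (Z\<^sup>n + t F\<^sup>m D\<^sup>n)\<close>, where \<open>Z = 1 + \<alpha> + \<alpha> t\<close> and \<open>D = (1 + \<alpha>) (1 + t)\<close>. As
  \<open>Z / D = 1 - t / D\<close> and the arguments of the powers of a non-real \<open>F\<close> spread out, some \<open>k\<close> gives
  \<open>|Z / D| > 1\<close>. The growth of \<open>(Z / D)\<^sup>n\<close> can then be balanced against that of \<open>t F\<^sup>m\<close> by the choice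
  of \<open>m / n\<close>, which produces zeros arbitrarily close to any given point.
\<close>

subsection \<open>Connected sets and simplicial vertices\<close>

text \<open>Arcs occur in both orientations, so the symmetric closure inside the definition changes
  nothing, and for walks starting in \<open>S\<close> the relativised closure agrees with the
  ordinary one.\<close>

lemma connected_sets_iff:
  assumes "pair_graph G"
  shows "S \<in> connected_sets G \<longleftrightarrow>
    S \<subseteq> pverts G \<and> S \<noteq> {} \<and> (\<forall>x\<in>S. \<forall>y\<in>S. (x, y) \<in> (parcs G \<inter> S \<times> S)\<^sup>*)"
proof -
  interpret pair_graph G by fact
  have ends: "arcs_ends (with_proj G \<restriction> S) = parcs G \<inter> S \<times> S"
    by (force simp: arcs_ends_conv)
  have "sym (parcs G \<inter> S \<times> S)"
    using pair_sym_arcs unfolding symmetric_def sym_def by simp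
  then have cl: "symcl (parcs G \<inter> S \<times> S) = parcs G \<inter> S \<times> S"
    unfolding symcl_def sym_def by auto
  have eq: "(x, y) \<in> rtrancl_on S (parcs G \<inter> S \<times> S) \<longleftrightarrow> (x, y) \<in> (parcs G \<inter> S \<times> S)\<^sup>*"
    if "x \<in> S" for x y
  proof
    assume "(x, y) \<in> (parcs G \<inter> S \<times> S)\<^sup>*"
    then show "(x, y) \<in> rtrancl_on S (parcs G \<inter> S \<times> S)"
      by induct (use that in \<open>auto intro: rtrancl_on_into_rtrancl_on\<close>)
  qed (rule rtrancl_on_rtranclI)
  show ?thesis
    unfolding connected_sets_def mem_Collect_eq connected_conv ends cl by (auto simp: eq)
qed

lemma finite_connected_sets: "pair_graph G \<Longrightarrow> finite (connected_sets G)"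
  by (rule finite_subset[of _ "Pow (pverts G)"])
    (auto simp: connected_sets_def pair_graph_def pair_digraph_def pair_fin_digraph.pair_finite_verts)

lemma connected_setsD:
  assumes "pair_graph G" "S \<in> connected_sets G"
  shows "S \<subseteq> pverts G" "S \<noteq> {}" "finite S"
proof -
  interpret pair_graph G by fact
  show "S \<subseteq> pverts G" "S \<noteq> {}" using assms by (auto simp: connected_sets_iff)
  then show "finite S" using pair_finite_verts finite_subset by blast
qed

section \<open>Adding a vertex whose neighbours form a clique\<close>

definition add_vertex :: "'a pair_pre_digraph \<Rightarrow> 'a \<Rightarrow> 'a set \<Rightarrow> 'a pair_pre_digraph" where
  "add_vertex G y A = \<lparr>pverts = insert y (pverts G), parcs = parcs G \<union> {y} \<times> A \<union> A \<times> {y}\<rparr>"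

lemma add_vertex_simps [simp]:
  "pverts (add_vertex G y A) = insert y (pverts G)"
  "parcs (add_vertex G y A) = parcs G \<union> {y} \<times> A \<union> A \<times> {y}"
  by (simp_all add: add_vertex_def)

lemma pair_graph_add_vertex:
  assumes "pair_graph G" "y \<notin> pverts G" "A \<subseteq> pverts G"
  shows "pair_graph (add_vertex G y A)"
proof -
  interpret pair_graph G by fact
  have "finite A" using assms pair_finite_verts finite_subset by blast
  moreover have "sym (parcs G)"
    using pair_sym_arcs by (simp add: symmetric_def)
  ultimately show ?thesis using assms(2,3) pair_finite_verts pair_finite_arcs
    by unfold_locales
      (auto simp: symmetric_def sym_def dest: in_arcsD1 in_arcsD2 no_loops')
qed

text \<open>Every graph below grows from a single vertex by such extensions, with \<open>A\<close> a
  vertex (leaves, centres of stars) or an edge (the two vertices of a gadget), so one recursion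
  serves throughout.\<close>

definition simplicial_extension :: "'a pair_pre_digraph \<Rightarrow> 'a \<Rightarrow> 'a set \<Rightarrow> bool" where
  "simplicial_extension G y A \<longleftrightarrow> pair_graph G \<and> y \<notin> pverts G \<and> A \<subseteq> pverts G \<and>
     (\<forall>a\<in>A. \<forall>b\<in>A. a \<noteq> b \<longrightarrow> (a, b) \<in> parcs G)"

text \<open>As the neighbourhood of the new vertex is a clique, detours through it can be short-cut.\<close>

lemma connected_sets_add_vertex:
  assumes "simplicial_extension G y A"
  shows "connected_sets (add_vertex G y A) =
    connected_sets G \<union> insert y ` {S \<in> connected_sets G. S \<inter> A \<noteq> {}} \<union> {{y}}" (is "?L = ?R")
proof -
  have G: "pair_graph G" and y: "y \<notin> pverts G" and A: "A \<subseteq> pverts G"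
    and cl: "\<And>a b. a \<in> A \<Longrightarrow> b \<in> A \<Longrightarrow> a \<noteq> b \<Longrightarrow> (a, b) \<in> parcs G"
    using assms by (auto simp: simplicial_extension_def)
  interpret pair_graph G by fact
  have G': "pair_graph (add_vertex G y A)" using G y A by (rule pair_graph_add_vertex)
  have yarc: "(a, y) \<notin> parcs G" "(y, a) \<notin> parcs G" for a
    using y by (auto dest: in_arcsD1 in_arcsD2)
  let ?E = "\<lambda>S. parcs G \<inter> S \<times> S"
  let ?E' = "\<lambda>S. (parcs G \<union> {y} \<times> A \<union> A \<times> {y}) \<inter> S \<times> S"
  have old: "S \<in> ?L \<longleftrightarrow> S \<in> connected_sets G" if "y \<notin> S" for S
  proof -
    have "?E' S = ?E S" using that by auto
    then show ?thesis using that by (auto simp: connected_sets_iff[OF G] connected_sets_iff[OF G'])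
  qed
  have "S \<in> ?R" if S: "S \<in> ?L" "y \<in> S" for S
  proof (cases "S = {y}")
    case False
    define T where "T = S - {y}"
    have T: "S = insert y T" "T \<noteq> {}" "T \<subseteq> pverts G" "y \<notin> T"
      using S False by (auto simp: T_def connected_sets_iff[OF G'])
    have conn: "(x, z) \<in> (?E' S)\<^sup>*" if "x \<in> S" "z \<in> S" for x z
      using S that by (auto simp: connected_sets_iff[OF G'])
    \<comment> \<open>Invariant of the induction along a walk in \<open>S\<close>: while the walk
      sits at \<open>y\<close>, all neighbours of \<open>y\<close> in \<open>T\<close> are already
      reachable inside \<open>T\<close>, so leaving \<open>y\<close> needs no knowledge of how it
      was entered.\<close>
    have path: "(z \<noteq> y \<longrightarrow> (x, z) \<in> (?E T)\<^sup>*) \<and>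
        (z = y \<longrightarrow> A \<inter> T \<noteq> {} \<and> (\<forall>a\<in>A \<inter> T. (x, a) \<in> (?E T)\<^sup>*))"
      if "x \<in> T" "(x, z) \<in> (?E' S)\<^sup>*" for x z
      using that(2)
    proof induct
      case base
      then show ?case using that T by auto
    next
      case (step z z')
      have IH: "z \<noteq> y \<Longrightarrow> (x, z) \<in> (?E T)\<^sup>*"
        "z = y \<Longrightarrow> a \<in> A \<inter> T \<Longrightarrow> (x, a) \<in> (?E T)\<^sup>*" for a
        using step(3) by auto
      consider "z = y" "z' \<noteq> y" "z' \<in> A \<inter> T" | "z \<noteq> y" "z' = y" "z \<in> A \<inter> T"
        | "z \<noteq> y" "z' \<noteq> y" "(z, z') \<in> ?E T"
        using step(2) T yarc A y by auto
      then show ?case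
      proof cases
        case 2
        have "(x, a) \<in> (?E T)\<^sup>*" if "a \<in> A \<inter> T" for a
        proof (cases "a = z")
          case False
          then have "(z, a) \<in> ?E T" using cl that 2 by auto
          with IH(1)[OF 2(1)] show ?thesis by (rule rtrancl_into_rtrancl)
        qed (use IH 2 in auto)
        then show ?thesis using 2 by auto
      qed (use IH in \<open>auto intro: rtrancl_into_rtrancl\<close>)
    qed
    have "T \<in> connected_sets G"
      unfolding connected_sets_iff[OF G] using T path conn by blast
    moreover have "T \<inter> A \<noteq> {}"
      using T path conn by blast
    ultimately show ?thesis using T by auto
  qed auto
  moreover have "insert y T \<in> ?L" if T: "T \<in> connected_sets G" "T \<inter> A \<noteq> {}" for T
  proof -
    obtain a where a: "a \<in> T" "a \<in> A" using T by auto
    let ?S = "insert y T"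
    have TT: "(x, z) \<in> (?E' ?S)\<^sup>*" if "x \<in> T" "z \<in> T" for x z
    proof -
      have "(x, z) \<in> (?E T)\<^sup>*" using T(1) that by (auto simp: connected_sets_iff[OF G])
      moreover have "?E T \<subseteq> ?E' ?S" by auto
      ultimately show ?thesis using rtrancl_mono by blast
    qed
    have ya: "(y, a) \<in> ?E' ?S" "(a, y) \<in> ?E' ?S" using a by auto
    have "(x, z) \<in> (?E' ?S)\<^sup>*" if "x \<in> ?S" "z \<in> ?S" for x z
    proof -
      have "(x, a) \<in> (?E' ?S)\<^sup>*" "(a, z) \<in> (?E' ?S)\<^sup>*"
        using that TT a ya by (auto intro: r_into_rtrancl)
      then show ?thesis by (rule rtrancl_trans)
    qed
    then show ?thesis using connected_setsD[OF G T(1)] y A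
      by (auto simp: connected_sets_iff[OF G'])
  qed
  moreover have "{y} \<in> ?L" by (auto simp: connected_sets_iff[OF G'])
  moreover have "y \<notin> S" if "S \<in> connected_sets G" for S
    using connected_setsD[OF G that] y by auto
  ultimately have "S \<in> ?L \<longleftrightarrow> S \<in> ?R" for S
    using old[of S] by (cases "y \<in> S") auto
  then show ?thesis by blast
qed

text \<open>The three families are disjoint and \<open>insert y\<close> is injective because
  \<open>y\<close> is new and connected sets are nonempty. The weight \<open>h\<close> is arbitrary
  so that it can remember the trace of a set on a smaller graph.\<close>

lemma sum_connected_sets_add_vertex:
  fixes h :: "'a set \<Rightarrow> 'b :: comm_monoid_add"
  assumes "simplicial_extension G y A"
  shows "(\<Sum>S\<in>connected_sets (add_vertex G y A). h S) =
    (\<Sum>S\<in>connected_sets G. h S + (if S \<inter> A \<noteq> {} then h (insert y S) else 0)) + h {y}"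
proof -
  have G: "pair_graph G" and y: "y \<notin> pverts G"
    using assms by (auto simp: simplicial_extension_def)
  let ?C = "connected_sets G" and ?M = "{S \<in> connected_sets G. S \<inter> A \<noteq> {}}"
  have fin: "finite ?C" "finite ?M" using finite_connected_sets[OF G] by auto
  have yS: "y \<notin> S" "S \<noteq> {}" if "S \<in> ?C" for S
    using connected_setsD[OF G that] y by auto
  have inj: "inj_on (insert y) ?M"
    using yS by (auto simp: inj_on_def) (metis insert_ident)+
  have d1: "(?C \<union> insert y ` ?M) \<inter> {{y}} = {}" 
  proof -
    have "insert y S \<noteq> {y}" if "S \<in> ?C" for S
      using yS[OF that] by auto
    then show ?thesis using yS by fastforce
  qed
  have d2: "?C \<inter> insert y ` ?M = {}" using yS by auto
  have "(\<Sum>S\<in>connected_sets (add_vertex G y A). h S) = sum h ?C + sum h (insert y ` ?M) + h {y}"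
    unfolding connected_sets_add_vertex[OF assms]
    using fin d1 d2 by (subst sum.union_disjoint; simp)+ 
  also have "sum h (insert y ` ?M) = (\<Sum>S\<in>?M. h (insert y S))"
    using inj by (simp add: sum.reindex)
  also have "\<dots> = (\<Sum>S\<in>?C. if S \<inter> A \<noteq> {} then h (insert y S) else 0)"
    using fin(1) by (simp add: sum.inter_filter)
  finally show ?thesis by (simp add: sum.distrib)
qed

subsection \<open>Hanging trees on a vertex\<close>

lemma ex_fresh_vertex:
  assumes "pair_graph (G :: nat pair_pre_digraph)"
  shows "\<exists>y. y \<notin> pverts G"
proof -
  interpret pair_graph G by fact
  show ?thesis using pair_finite_verts ex_new_if_finite infinite_UNIV_nat by blast
qed

text \<open>
  \<open>G'\<close> arises from \<open>G\<close> by hanging new vertices on \<open>x\<close>. A connected set of \<open>G\<close> through \<open>x\<close>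
  extends into the new part with generating function \<open>\<Phi>\<close>, and \<open>\<delta>\<close> counts the connected sets that
  lie entirely in the new part. The test function \<open>g\<close> is what makes the relation compose.
\<close>

definition attached ::
  "'a pair_pre_digraph \<Rightarrow> 'a \<Rightarrow> (complex \<Rightarrow> complex) \<Rightarrow> (complex \<Rightarrow> complex) \<Rightarrow>
   'a pair_pre_digraph \<Rightarrow> bool" where
  "attached G x \<Phi> \<delta> G' \<longleftrightarrow> pair_graph G' \<and> pverts G \<subseteq> pverts G' \<and> parcs G \<subseteq> parcs G' \<and>
     (\<forall>g t. (\<Sum>S\<in>connected_sets G'. g (S \<inter> pverts G) * t ^ card S) =
        (\<Sum>S\<in>connected_sets G. g S * t ^ card S * (if x \<in> S then \<Phi> t else 1)) + g {} * \<delta> t)"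

lemma attachedD:
  assumes "attached G x \<Phi> \<delta> G'"
  shows "pair_graph G'" "pverts G \<subseteq> pverts G'" "parcs G \<subseteq> parcs G'"
    and "(\<Sum>S\<in>connected_sets G'. g (S \<inter> pverts G) * t ^ card S) =
        (\<Sum>S\<in>connected_sets G. g S * t ^ card S * (if x \<in> S then \<Phi> t else 1)) + g {} * \<delta> t"
  using assms by (auto simp: attached_def)

lemma attached_refl:
  assumes "pair_graph G"
  shows "attached G x (\<lambda>t. 1) (\<lambda>t. 0) G"
  using assms connected_setsD(1)[OF assms]
  by (auto simp: attached_def Int_absorb2 intro!: sum.cong)

text \<open>Since \<open>x\<close> lies in \<open>G\<close>, the trace on \<open>G\<close> decides
  whether \<open>x\<close> is in a set, so the factor from the second step can be absorbed into the
  test function. At the empty trace this factor is 1, whence the corrections add.\<close>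

lemma attached_trans:
  assumes "attached G x \<Phi> \<delta> G'" "attached G' x \<Psi> \<epsilon> G''" "x \<in> pverts G"
  shows "attached G x (\<lambda>t. \<Phi> t * \<Psi> t) (\<lambda>t. \<delta> t + \<epsilon> t) G''"
proof -
  have sub: "pverts G \<subseteq> pverts G'" "parcs G \<subseteq> parcs G'" "pverts G' \<subseteq> pverts G''"
      "parcs G' \<subseteq> parcs G''" "pair_graph G''"
    using assms by (auto simp: attached_def)
  have 1: "(\<Sum>S\<in>connected_sets G'. g (S \<inter> pverts G) * t ^ card S) =
      (\<Sum>S\<in>connected_sets G. g S * t ^ card S * (if x \<in> S then \<Phi> t else 1)) + g {} * \<delta> t" for g t
    using assms(1) by (simp add: attached_def)
  have 2: "(\<Sum>S\<in>connected_sets G''. g (S \<inter> pverts G') * t ^ card S) =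
      (\<Sum>S\<in>connected_sets G'. g S * t ^ card S * (if x \<in> S then \<Psi> t else 1)) + g {} * \<epsilon> t" for g t
    using assms(2) by (simp add: attached_def)
  have "(\<Sum>S\<in>connected_sets G''. g (S \<inter> pverts G) * t ^ card S) =
    (\<Sum>S\<in>connected_sets G. g S * t ^ card S * (if x \<in> S then \<Phi> t * \<Psi> t else 1)) +
      g {} * (\<delta> t + \<epsilon> t)" for g t
  proof -
    have "S \<inter> pverts G' \<inter> pverts G = S \<inter> pverts G" for S using sub by auto
    then have "(\<Sum>S\<in>connected_sets G''. g (S \<inter> pverts G) * t ^ card S) =
        (\<Sum>S\<in>connected_sets G'. g (S \<inter> pverts G) * t ^ card S * (if x \<in> S then \<Psi> t else 1)) + g {} * \<epsilon> t"
      using 2[of "\<lambda>S. g (S \<inter> pverts G)" t] by simp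
    also have "(\<Sum>S\<in>connected_sets G'. g (S \<inter> pverts G) * t ^ card S * (if x \<in> S then \<Psi> t else 1)) =
       (\<Sum>S\<in>connected_sets G'. (g (S \<inter> pverts G) * (if x \<in> S \<inter> pverts G then \<Psi> t else 1)) * t ^ card S)"
      using assms(3) by (intro sum.cong) auto
    also have "\<dots> = (\<Sum>S\<in>connected_sets G. g S * (if x \<in> S then \<Psi> t else 1) * t ^ card S * (if x \<in> S then \<Phi> t else 1))
        + g {} * \<delta> t"
      using 1[of "\<lambda>S. g S * (if x \<in> S then \<Psi> t else 1)" t] by simp
    also have "(\<Sum>S\<in>connected_sets G. g S * (if x \<in> S then \<Psi> t else 1) * t ^ card S * (if x \<in> S then \<Phi> t else 1)) =
      (\<Sum>S\<in>connected_sets G. g S * t ^ card S * (if x \<in> S then \<Phi> t * \<Psi> t else 1))"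
      by (intro sum.cong) auto
    finally show ?thesis by (simp add: algebra_simps)
  qed
  then show ?thesis using sub by (auto simp: attached_def)
qed

text \<open>A set through \<open>x\<close> either stops there, giving 1, or takes \<open>y\<close>
  and continues below it, giving \<open>t * \<Phi> t\<close>. The sets missing \<open>G\<close> are
  those through \<open>y\<close> and those strictly below \<open>y\<close>.\<close>

lemma attached_branch:
  assumes "pair_graph G" "x \<in> pverts G" "y \<notin> pverts G"
    and "attached (add_vertex G y {x}) y \<Phi> \<delta> G'"
  shows "attached G x (\<lambda>t. 1 + t * \<Phi> t) (\<lambda>t. t * \<Phi> t + \<delta> t) G'"
proof -
  let ?H = "add_vertex G y {x}"
  have se: "simplicial_extension G y {x}" using assms by (auto simp: simplicial_extension_def)
  have "(\<Sum>S\<in>connected_sets G'. g (S \<inter> pverts G) * t ^ card S) =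
    (\<Sum>S\<in>connected_sets G. g S * t ^ card S * (if x \<in> S then 1 + t * \<Phi> t else 1)) +
      g {} * (t * \<Phi> t + \<delta> t)" for g t
  proof -
    have int: "S \<inter> pverts ?H \<inter> pverts G = S \<inter> pverts G" for S by auto
    have "(\<Sum>S\<in>connected_sets G'. g (S \<inter> pverts ?H \<inter> pverts G) * t ^ card S) =
      (\<Sum>S\<in>connected_sets ?H. g (S \<inter> pverts G) * t ^ card S * (if y \<in> S then \<Phi> t else 1)) + g ({} \<inter> pverts G) * \<delta> t"
      by (rule attachedD(4)[OF assms(4)])
    also have "(\<Sum>S\<in>connected_sets ?H. g (S \<inter> pverts G) * t ^ card S * (if y \<in> S then \<Phi> t else 1)) =
       (\<Sum>S\<in>connected_sets G. g (S \<inter> pverts G) * t ^ card S * (if y \<in> S then \<Phi> t else 1) +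
         (if S \<inter> {x} \<noteq> {} then g (insert y S \<inter> pverts G) * t ^ card (insert y S) * (if y \<in> insert y S then \<Phi> t else 1) else 0))
       + g ({y} \<inter> pverts G) * t ^ card {y} * (if y \<in> {y} then \<Phi> t else 1)"
      by (rule sum_connected_sets_add_vertex[OF se])
    also have "\<dots> = (\<Sum>S\<in>connected_sets G. g S * t ^ card S * (if x \<in> S then 1 + t * \<Phi> t else 1))
       + g {} * t * \<Phi> t"
    proof -
      have "g (S \<inter> pverts G) * t ^ card S * (if y \<in> S then \<Phi> t else 1) +
         (if S \<inter> {x} \<noteq> {} then g (insert y S \<inter> pverts G) * t ^ card (insert y S) * (if y \<in> insert y S then \<Phi> t else 1) else 0)
         = g S * t ^ card S * (if x \<in> S then 1 + t * \<Phi> t else 1)" if "S \<in> connected_sets G" for S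
      proof -
        have S: "S \<subseteq> pverts G" "finite S" "y \<notin> S"
          using connected_setsD[OF assms(1) that] assms(3) by auto
        then have "S \<inter> pverts G = S" "insert y S \<inter> pverts G = S" using assms(3) by auto
        then show ?thesis using S by (simp add: algebra_simps)
      qed
      moreover have "{y} \<inter> pverts G = {}" using assms(3) by auto
      ultimately show ?thesis by simp
    qed
    finally show ?thesis unfolding int by (simp add: algebra_simps)
  qed
  then show ?thesis using assms(4) by (auto simp: attached_def)
qed

lemma ex_attached_power:
  assumes ex: "\<And>G :: nat pair_pre_digraph. pair_graph G \<Longrightarrow> x \<in> pverts G \<Longrightarrow> \<exists>G'. attached G x \<Phi> \<delta> G'"
    and "pair_graph G" "x \<in> pverts G"
  shows "\<exists>G'. attached G x (\<lambda>t. \<Phi> t ^ k) (\<lambda>t. of_nat k * \<delta> t) G'"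
proof (induction k)
  case 0
  then show ?case using attached_refl[OF assms(2), of x] by auto
next
  case (Suc k)
  then obtain G' where G': "attached G x (\<lambda>t. \<Phi> t ^ k) (\<lambda>t. of_nat k * \<delta> t) G'" by blast
  then obtain G'' where "attached G' x \<Phi> \<delta> G''"
    using ex[of G'] attachedD(1,2)[OF G'] assms(3) by blast
  from attached_trans[OF G' this assms(3)] show ?case by (auto simp: algebra_simps)
qed

text \<open>A leaf gives its neighbour the factor \<open>1 + t\<close>; \<open>K\<close> leaves on a
  new vertex \<open>y\<close> followed by one branching step at \<open>x\<close> give the star. The
  correction counts the sets through the centre and the \<open>K\<close> single leaves.\<close>

lemma ex_attached_star:
  fixes G :: "nat pair_pre_digraph"
  assumes "pair_graph G" "x \<in> pverts G"
  shows "\<exists>G'. attached G x (\<lambda>t. 1 + t * (1 + t) ^ K) (\<lambda>t. t * (1 + t) ^ K + of_nat K * t) G'"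
proof -
  have leaf: "\<exists>G'. attached G x (\<lambda>t. 1 + t) (\<lambda>t. t) G'"
    if G: "pair_graph G" and x: "x \<in> pverts G" for G :: "nat pair_pre_digraph" and x
  proof -
    obtain y where y: "y \<notin> pverts G" using ex_fresh_vertex[OF G] by blast
    have "attached (add_vertex G y {x}) y (\<lambda>t. 1) (\<lambda>t. 0) (add_vertex G y {x})"
      using G x y by (intro attached_refl pair_graph_add_vertex) auto
    from attached_branch[OF G x y this] show ?thesis by auto
  qed
  obtain y where y: "y \<notin> pverts G" using ex_fresh_vertex[OF assms(1)] by blast
  have "pair_graph (add_vertex G y {x})"
    using assms y by (intro pair_graph_add_vertex) auto
  then obtain G' where "attached (add_vertex G y {x}) y (\<lambda>t. (1 + t) ^ K) (\<lambda>t. of_nat K * t) G'"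
    using ex_attached_power[OF leaf, of y "add_vertex G y {x}" K] by auto
  from attached_branch[OF assms y this] show ?thesis by blast
qed

definition star_gf :: "nat \<Rightarrow> complex \<Rightarrow> complex" where
  "star_gf K t = 1 + t * (1 + t) ^ K"

lemma ex_attached_stars:
  fixes G :: "nat pair_pre_digraph"
  assumes "pair_graph G" "x \<in> pverts G"
  shows "\<exists>G'. attached G x (\<lambda>t. star_gf K t ^ k)
           (\<lambda>t. of_nat k * (t * (1 + t) ^ K + of_nat K * t)) G'"
  using ex_attached_power[OF ex_attached_star assms] by (simp add: star_gf_def)

text \<open>
  The gadget consists of a vertex \<open>a\<close> adjacent to \<open>u\<close> and \<open>v\<close>, a vertex \<open>b\<close> adjacent to \<open>a\<close> and \<open>v\<close>,
  and \<open>k\<close> stars hung on \<open>a\<close>. Given \<open>u \<in> S\<close>, the vertex \<open>a\<close> is always reachable, while \<open>b\<close> needs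
  \<open>a\<close> or \<open>v\<close>: the factor depends on whether \<open>v \<in> S\<close>.
\<close>

lemma ex_gadget:
  fixes G :: "nat pair_pre_digraph" and K k :: nat
  assumes G: "pair_graph G" and uv: "(u, v) \<in> parcs G"
  defines "\<alpha> \<equiv> \<lambda>t. t * star_gf K t ^ k"
  shows "\<exists>G'. pair_graph G' \<and> pverts G \<subseteq> pverts G' \<and> parcs G \<subseteq> parcs G' \<and>
     (\<forall>g t. (\<forall>S. u \<notin> S \<longrightarrow> g S = 0) \<longrightarrow>
        (\<Sum>S\<in>connected_sets G'. g (S \<inter> pverts G) * t ^ card S) =
        (\<Sum>S\<in>connected_sets G. g S * t ^ card S *
           (if v \<in> S then (1 + \<alpha> t) * (1 + t) else 1 + \<alpha> t + \<alpha> t * t)))"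
proof -
  interpret pair_graph G by fact
  have uv': "u \<in> pverts G" "v \<in> pverts G" "(v, u) \<in> parcs G"
    using uv pair_sym_arcs by (auto simp: symmetric_def sym_def dest: in_arcsD1 in_arcsD2)
  obtain a where a: "a \<notin> pverts G" using ex_fresh_vertex[OF G] by blast
  define H where "H = add_vertex G a {u, v}"
  have se1: "simplicial_extension G a {u, v}"
    using G a uv uv' by (auto simp: simplicial_extension_def)
  have H: "pair_graph H" unfolding H_def using G a uv' by (intro pair_graph_add_vertex) auto
  obtain b where b: "b \<notin> pverts H" using ex_fresh_vertex[OF H] by blast
  define I where "I = add_vertex H b {a, v}"
  have se2: "simplicial_extension H b {a, v}"
    using H b uv' by (auto simp: simplicial_extension_def H_def)
  have I: "pair_graph I" unfolding I_def using H b uv' by (intro pair_graph_add_vertex) (auto simp: H_def)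
  have VI: "pverts I = insert b (insert a (pverts G))" by (simp add: I_def H_def)
  have bG: "b \<notin> pverts G" "b \<noteq> a" using b by (auto simp: H_def)
  obtain G' \<delta> where G': "attached I a (\<lambda>t. star_gf K t ^ k) \<delta> G'"
    using ex_attached_stars[OF I, of a K k] VI by auto
  have "(\<Sum>S\<in>connected_sets G'. g (S \<inter> pverts G) * t ^ card S) =
        (\<Sum>S\<in>connected_sets G. g S * t ^ card S *
           (if v \<in> S then (1 + \<alpha> t) * (1 + t) else 1 + \<alpha> t + \<alpha> t * t))"
    if g: "\<And>S. u \<notin> S \<Longrightarrow> g S = 0" for g t
  proof -
    \<comment> \<open>The weight left on \<open>I\<close> once the stars on \<open>a\<close> are
      summed out; \<open>b\<close> and \<open>a\<close> are then peeled off in reverse order. Since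
      \<open>g\<close> vanishes on sets without \<open>u\<close>, all sets lying in the new part
      drop out.\<close>
    define h where "h S = g (S \<inter> pverts G) * t ^ card S * (if a \<in> S then star_gf K t ^ k else 1)" for S
    have int: "S \<inter> pverts I \<inter> pverts G = S \<inter> pverts G" for S using VI by auto
    have "(\<Sum>S\<in>connected_sets G'. g (S \<inter> pverts I \<inter> pverts G) * t ^ card S) =
        sum h (connected_sets I) + g ({} \<inter> pverts G) * \<delta> t"
      unfolding h_def by (rule attachedD(4)[OF G'])
    also have "\<dots> = sum h (connected_sets I)" using g by simp
    also have "\<dots> = (\<Sum>S\<in>connected_sets H. h S + (if S \<inter> {a, v} \<noteq> {} then h (insert b S) else 0)) + h {b}"
      unfolding I_def by (rule sum_connected_sets_add_vertex[OF se2])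
    also have "h {b} = 0" using bG g by (simp add: h_def)
    also have "(\<Sum>S\<in>connected_sets H. h S + (if S \<inter> {a, v} \<noteq> {} then h (insert b S) else 0)) =
       (\<Sum>S\<in>connected_sets G. (h S + (if S \<inter> {a, v} \<noteq> {} then h (insert b S) else 0))
         + (if S \<inter> {u, v} \<noteq> {} then h (insert a S) +
              (if insert a S \<inter> {a, v} \<noteq> {} then h (insert b (insert a S)) else 0) else 0))
        + (h {a} + (if {a} \<inter> {a, v} \<noteq> {} then h (insert b {a}) else 0))"
      unfolding H_def by (rule sum_connected_sets_add_vertex[OF se1])
    also have "h {a} + (if {a} \<inter> {a, v} \<noteq> {} then h (insert b {a}) else 0) = 0"
      using a bG g by (simp add: h_def)
    also have "(\<Sum>S\<in>connected_sets G. (h S + (if S \<inter> {a, v} \<noteq> {} then h (insert b S) else 0))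
         + (if S \<inter> {u, v} \<noteq> {} then h (insert a S) +
              (if insert a S \<inter> {a, v} \<noteq> {} then h (insert b (insert a S)) else 0) else 0)) =
       (\<Sum>S\<in>connected_sets G. g S * t ^ card S *
           (if v \<in> S then (1 + \<alpha> t) * (1 + t) else 1 + \<alpha> t + \<alpha> t * t))"
    proof (intro sum.cong refl)
      fix S assume "S \<in> connected_sets G"
      then have S: "S \<subseteq> pverts G" "finite S" using connected_setsD[OF G] by auto
      then have nin: "a \<notin> S" "b \<notin> S" using a bG by auto
      have gS: "S \<inter> pverts G = S" "insert a S \<inter> pverts G = S" "insert b S \<inter> pverts G = S"
        "insert b (insert a S) \<inter> pverts G = S"
        using S a bG by auto
      have hs: "h S = g S * t ^ card S" "h (insert a S) = g S * t ^ card S * \<alpha> t"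
        "h (insert b S) = g S * t ^ card S * t"
        "h (insert b (insert a S)) = g S * t ^ card S * \<alpha> t * t"
        using nin S bG by (simp_all add: h_def gS \<alpha>_def)
      show "(h S + (if S \<inter> {a, v} \<noteq> {} then h (insert b S) else 0))
         + (if S \<inter> {u, v} \<noteq> {} then h (insert a S) +
              (if insert a S \<inter> {a, v} \<noteq> {} then h (insert b (insert a S)) else 0) else 0) =
         g S * t ^ card S * (if v \<in> S then (1 + \<alpha> t) * (1 + t) else 1 + \<alpha> t + \<alpha> t * t)"
      proof (cases "u \<in> S")
        case True
        then show ?thesis unfolding hs using nin by (auto simp: algebra_simps)
      next
        case False
        then show ?thesis unfolding hs using g by simp
      qed
    qed
    finally show ?thesis unfolding int by simp
  qed
  moreover have "pair_graph G'" "pverts G \<subseteq> pverts G'" "parcs G \<subseteq> parcs G'"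
    using G' VI by (auto simp: attached_def I_def H_def)
  ultimately show ?thesis by blast
qed

text \<open>All gadgets sit on the same edge, so their factors multiply: the factor of the latest
  one depends only on whether \<open>v\<close> is in the trace, and goes into the test function,
  which still vanishes off \<open>u\<close>.\<close>

lemma ex_gadgets:
  fixes G :: "nat pair_pre_digraph" and K k n :: nat
  assumes G: "pair_graph G" and uv: "(u, v) \<in> parcs G"
  defines "\<alpha> \<equiv> \<lambda>t. t * star_gf K t ^ k"
  shows "\<exists>G'. pair_graph G' \<and> pverts G \<subseteq> pverts G' \<and> parcs G \<subseteq> parcs G' \<and>
     (\<forall>g t. (\<forall>S. u \<notin> S \<longrightarrow> g S = 0) \<longrightarrow>
        (\<Sum>S\<in>connected_sets G'. g (S \<inter> pverts G) * t ^ card S) =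
        (\<Sum>S\<in>connected_sets G. g S * t ^ card S *
           (if v \<in> S then (1 + \<alpha> t) * (1 + t) else 1 + \<alpha> t + \<alpha> t * t) ^ n))"
proof (induction n)
  case 0
  have "(\<Sum>S\<in>connected_sets G. g (S \<inter> pverts G) * t ^ card S) = (\<Sum>S\<in>connected_sets G. g S * t ^ card S)"
    for g :: "nat set \<Rightarrow> complex" and t
    using connected_setsD(1)[OF G] by (intro sum.cong) (auto simp: Int_absorb2)
  then show ?case using G by (intro exI[of _ G]) auto
next
  case (Suc n)
  let ?f = "\<lambda>S t. if v \<in> S then (1 + \<alpha> t) * (1 + t) else 1 + \<alpha> t + \<alpha> t * t"
  obtain H where H: "pair_graph H" "pverts G \<subseteq> pverts H" "parcs G \<subseteq> parcs H"
    and eqH: "\<And>g t. (\<And>S. u \<notin> S \<Longrightarrow> g S = 0) \<Longrightarrow>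
        (\<Sum>S\<in>connected_sets H. g (S \<inter> pverts G) * t ^ card S) =
        (\<Sum>S\<in>connected_sets G. g S * t ^ card S * ?f S t ^ n)"
    using Suc.IH by blast
  have "(u, v) \<in> parcs H" using uv H by auto
  from ex_gadget[OF H(1) this, of K k] obtain G' where
    G': "pair_graph G'" "pverts H \<subseteq> pverts G'" "parcs H \<subseteq> parcs G'"
    and eqG: "\<And>g t. (\<And>S. u \<notin> S \<Longrightarrow> g S = 0) \<Longrightarrow>
        (\<Sum>S\<in>connected_sets G'. g (S \<inter> pverts H) * t ^ card S) =
        (\<Sum>S\<in>connected_sets H. g S * t ^ card S * ?f S t)"
    unfolding \<alpha>_def by blast
  interpret pair_graph G by fact
  have v: "v \<in> pverts G" using uv by (auto dest: in_arcsD2)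
  have "(\<Sum>S\<in>connected_sets G'. g (S \<inter> pverts G) * t ^ card S) =
        (\<Sum>S\<in>connected_sets G. g S * t ^ card S * ?f S t ^ Suc n)"
    if g: "\<And>S. u \<notin> S \<Longrightarrow> g S = 0" for g t
  proof -
    have int: "S \<inter> pverts H \<inter> pverts G = S \<inter> pverts G" for S using H by auto
    have "(\<Sum>S\<in>connected_sets G'. g (S \<inter> pverts H \<inter> pverts G) * t ^ card S) =
        (\<Sum>S\<in>connected_sets H. g (S \<inter> pverts G) * t ^ card S * ?f S t)"
      using g by (intro eqG[of "\<lambda>S. g (S \<inter> pverts G)"]) auto
    also have "\<dots> = (\<Sum>S\<in>connected_sets H. (g (S \<inter> pverts G) * ?f (S \<inter> pverts G) t) * t ^ card S)"
      using v by (intro sum.cong) auto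
    also have "\<dots> = (\<Sum>S\<in>connected_sets G. (g S * ?f S t) * t ^ card S * ?f S t ^ n)"
      using g by (intro eqH[of "\<lambda>S. g S * ?f S t"]) auto
    also have "\<dots> = (\<Sum>S\<in>connected_sets G. g S * t ^ card S * ?f S t ^ Suc n)"
      by (intro sum.cong) auto
    finally show ?thesis unfolding int .
  qed
  then show ?case using H G' by (intro exI[of _ G']) blast
qed

subsection \<open>The graphs\<close>

definition connected_gf :: "'a pair_pre_digraph \<Rightarrow> complex \<Rightarrow> complex" where
  "connected_gf G t = (\<Sum>S\<in>connected_sets G. t ^ card S)"

lemma poly_NRel:
  assumes G: "pair_graph G" and z: "z \<noteq> 1"
  shows "poly (NRel G) z = (1 - z) ^ card (pverts G) * connected_gf G (z / (1 - z))"
proof -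
  interpret pair_graph G by fact
  let ?n = "card (pverts G)" and ?C = "connected_sets G"
  have cS: "card S \<in> {1..?n}" if "S \<in> ?C" for S
    using connected_setsD[OF G that] pair_finite_verts
    by (auto simp: Suc_le_eq card_gt_0_iff intro: card_mono)
  have fin: "finite ?C" using finite_connected_sets[OF G] .
  have "poly (NRel G) z = (\<Sum>k=1..?n. of_nat (num_connected_sets G k) * (z ^ k * (1 - z) ^ (?n - k)))"
    by (simp add: NRel_def Let_def poly_sum)
  also have "\<dots> = (\<Sum>k=1..?n. \<Sum>S\<in>{S \<in> ?C. card S = k}. z ^ card S * (1 - z) ^ (?n - card S))"
    by (intro sum.cong refl) (simp add: num_connected_sets_def)
  also have "\<dots> = (\<Sum>S\<in>?C. z ^ card S * (1 - z) ^ (?n - card S))"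
    using fin cS by (intro sum.group) auto
  also have "\<dots> = (\<Sum>S\<in>?C. (1 - z) ^ ?n * (z / (1 - z)) ^ card S)"
  proof (intro sum.cong refl)
    fix S assume "S \<in> ?C"
    then have "(1 - z) ^ ?n = (1 - z) ^ (?n - card S) * (1 - z) ^ card S"
      using cS[of S] by (simp flip: power_add)
    then show "z ^ card S * (1 - z) ^ (?n - card S) = (1 - z) ^ ?n * (z / (1 - z)) ^ card S"
      using z by (simp add: power_divide)
  qed
  finally show ?thesis by (simp add: connected_gf_def sum_distrib_left)
qed

text \<open>\<open>num_gf\<close> and \<open>den_gf\<close> are the factors \<open>Z\<close> and
  \<open>D\<close> that one gadget contributes to sets containing \<open>u\<close> which avoid,
  respectively contain, \<open>v\<close>.\<close>

definition num_gf :: "nat \<Rightarrow> nat \<Rightarrow> complex \<Rightarrow> complex" where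
  "num_gf K k t = 1 + t * star_gf K t ^ k + t * star_gf K t ^ k * t"

definition den_gf :: "nat \<Rightarrow> nat \<Rightarrow> complex \<Rightarrow> complex" where
  "den_gf K k t = (1 + t * star_gf K t ^ k) * (1 + t)"

text \<open>The two summands belong to the connected sets \<open>{u}\<close> and
  \<open>{u, v}\<close> of the initial edge.\<close>

definition core_gf :: "nat \<Rightarrow> nat \<Rightarrow> nat \<Rightarrow> nat \<Rightarrow> complex \<Rightarrow> complex" where
  "core_gf K k m n t = t * (num_gf K k t ^ n + t * star_gf K t ^ m * den_gf K k t ^ n)"

lemma ex_core_graph:
  "\<exists>(G :: nat pair_pre_digraph) u. pair_graph G \<and> u \<in> pverts G \<and>
     (\<forall>t. (\<Sum>S\<in>{S \<in> connected_sets G. u \<in> S}. t ^ card S) = core_gf K k m n t)"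
proof -
  define O1 :: "nat pair_pre_digraph" where "O1 = \<lparr>pverts = {0}, parcs = {}\<rparr>"
  have O1: "pair_graph O1" "pverts O1 = {0}"
    by unfold_locales (simp_all add: O1_def symmetric_def sym_def)
  have csO: "connected_sets O1 = {{0}}"
  proof (intro set_eqI iffI)
    fix S assume "S \<in> connected_sets O1"
    from connected_setsD(1,2)[OF O1(1) this] O1(2) show "S \<in> {{0}}" by auto
  qed (simp add: connected_sets_iff[OF O1(1)] O1(2))
  define H where "H = add_vertex O1 1 {0}"
  have se: "simplicial_extension O1 1 {0}" using O1 by (auto simp: simplicial_extension_def)
  have H: "pair_graph H" "pverts H = {0, 1}" "(0, 1) \<in> parcs H"
    unfolding H_def using O1 by (auto intro!: pair_graph_add_vertex)
  then obtain I \<delta> where I: "attached H 1 (\<lambda>t. star_gf K t ^ m) \<delta> I"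
    using ex_attached_stars[OF H(1), of 1 K m] by auto
  then have I': "pair_graph I" "(0, 1) \<in> parcs I" "pverts H \<subseteq> pverts I"
    using H by (auto simp: attached_def)
  let ?f = "\<lambda>S t. if (1 :: nat) \<in> S then den_gf K k t else num_gf K k t"
  obtain G where G: "pair_graph G" "pverts I \<subseteq> pverts G" and
    eqG: "\<And>g t. (\<And>S. 0 \<notin> S \<Longrightarrow> g S = 0) \<Longrightarrow>
        (\<Sum>S\<in>connected_sets G. g (S \<inter> pverts I) * t ^ card S) =
        (\<Sum>S\<in>connected_sets I. g S * t ^ card S * ?f S t ^ n)"
    using ex_gadgets[OF I'(1,2), of K k n] unfolding num_gf_def den_gf_def by blast
  have "(\<Sum>S\<in>{S \<in> connected_sets G. 0 \<in> S}. t ^ card S) = core_gf K k m n t" for t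
  proof -
    \<comment> \<open>The vertices 0 and 1 play the roles of \<open>u\<close> and \<open>v\<close>.
      This indicator of \<open>u\<close> vanishes at the empty set, which also removes the
      correction \<open>\<delta>\<close> of the stars on \<open>v\<close>.\<close>
    define g where "g S = (if (0::nat) \<in> S then 1 else 0 :: complex)" for S
    have "(\<Sum>S\<in>{S \<in> connected_sets G. 0 \<in> S}. t ^ card S) =
        (\<Sum>S\<in>connected_sets G. if 0 \<in> S then t ^ card S else 0)"
      using finite_connected_sets[OF G(1)] by (simp add: sum.inter_filter)
    also have "\<dots> = (\<Sum>S\<in>connected_sets G. g (S \<inter> pverts I) * t ^ card S)"
      using H I' by (intro sum.cong) (auto simp: g_def)
    also have "\<dots> = (\<Sum>S\<in>connected_sets I. g S * t ^ card S * ?f S t ^ n)"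
      by (rule eqG) (simp add: g_def)
    also have "\<dots> = (\<Sum>S\<in>connected_sets I. (g (S \<inter> pverts H) * ?f (S \<inter> pverts H) t ^ n) * t ^ card S)"
      using H by (intro sum.cong) (auto simp: g_def)
    also have "\<dots> = (\<Sum>S\<in>connected_sets H. (g S * ?f S t ^ n) * t ^ card S *
         (if 1 \<in> S then star_gf K t ^ m else 1)) + (g {} * ?f {} t ^ n) * \<delta> t"
      by (rule attachedD(4)[OF I, where g = "\<lambda>S. g S * ?f S t ^ n"])
    also have "\<dots> = (\<Sum>S\<in>connected_sets H. (g S * ?f S t ^ n) * t ^ card S *
         (if 1 \<in> S then star_gf K t ^ m else 1))" by (simp add: g_def)
    also have "\<dots> = core_gf K k m n t"
      unfolding H_def by (subst sum_connected_sets_add_vertex[OF se])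
        (simp add: csO g_def core_gf_def algebra_simps)
    finally show ?thesis .
  qed
  then show ?thesis using G I' H by blast
qed

text \<open>\<open>N\<close> collects the sets avoiding \<open>u\<close> in the core graph, and
  \<open>of_nat l * \<delta> t\<close> those inside the \<open>l\<close> stars hung on
  \<open>u\<close>. Neither \<open>N\<close> nor \<open>\<delta>\<close> depends on
  \<open>l\<close>, so only the first term can grow exponentially.\<close>

lemma ex_graph_family:
  "\<exists>N \<delta>. N holomorphic_on UNIV \<and> \<delta> holomorphic_on UNIV \<and>
     (\<forall>l. \<exists>G :: nat pair_pre_digraph. pair_graph G \<and> pverts G \<noteq> {} \<and>
        (\<forall>t. connected_gf G t = star_gf K t ^ l * core_gf K k m n t + N t + of_nat l * \<delta> t))"
proof -
  obtain G :: "nat pair_pre_digraph" and u where G: "pair_graph G" "u \<in> pverts G"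
    and core: "\<And>t. (\<Sum>S\<in>{S \<in> connected_sets G. u \<in> S}. t ^ card S) = core_gf K k m n t"
    using ex_core_graph by metis
  define N :: "complex \<Rightarrow> complex" where "N t = (\<Sum>S\<in>{S \<in> connected_sets G. u \<notin> S}. t ^ card S)" for t
  define \<delta> :: "complex \<Rightarrow> complex" where "\<delta> t = t * (1 + t) ^ K + of_nat K * t" for t
  have "\<exists>G' :: nat pair_pre_digraph. pair_graph G' \<and> pverts G' \<noteq> {} \<and>
        (\<forall>t. connected_gf G' t = star_gf K t ^ l * core_gf K k m n t + N t + of_nat l * \<delta> t)" for l
  proof -
    obtain G' where G': "attached G u (\<lambda>t. star_gf K t ^ l) (\<lambda>t. of_nat l * \<delta> t) G'"
      using ex_attached_stars[OF G, of K l] unfolding \<delta>_def by blast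
    have "connected_gf G' t = star_gf K t ^ l * core_gf K k m n t + N t + of_nat l * \<delta> t" for t
    proof -
      have "connected_gf G' t = (\<Sum>S\<in>connected_sets G'. 1 * t ^ card S)"
        by (simp add: connected_gf_def)
      also have "\<dots> = (\<Sum>S\<in>connected_sets G. 1 * t ^ card S * (if u \<in> S then star_gf K t ^ l else 1))
          + 1 * (of_nat l * \<delta> t)"
        by (rule attachedD(4)[OF G'])
      also have "(\<Sum>S\<in>connected_sets G. 1 * t ^ card S * (if u \<in> S then star_gf K t ^ l else 1)) =
         (\<Sum>S\<in>connected_sets G. (if u \<in> S then t ^ card S * star_gf K t ^ l else 0)
            + (if u \<notin> S then t ^ card S else 0))"
        by (intro sum.cong) auto
      also have "\<dots> = (\<Sum>S\<in>{S \<in> connected_sets G. u \<in> S}. t ^ card S) * star_gf K t ^ l + N t"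
        unfolding N_def sum_distrib_right
        using finite_connected_sets[OF G(1)] by (simp add: sum.inter_filter sum.distrib)
      finally show ?thesis by (simp add: core algebra_simps)
    qed
    moreover have "pair_graph G'" "pverts G' \<noteq> {}" using G' G by (auto simp: attached_def)
    ultimately show ?thesis by blast
  qed
  moreover have "N holomorphic_on UNIV" "\<delta> holomorphic_on UNIV"
    unfolding N_def \<delta>_def by (intro holomorphic_intros)+
  ultimately show ?thesis by blast
qed

subsection \<open>Powers of complex numbers and zeros of limits\<close>

text \<open>
  The sums of \<open>Re (c u\<^sup>k)\<close> stay bounded while those of its square grow linearly, so the negative parts
  cannot be summable.
\<close>

lemma Re_mult_power_not_bounded_below:
  fixes u c :: complex and b :: "nat \<Rightarrow> real"
  assumes u: "norm u = 1" "u \<noteq> 1" "u \<noteq> -1" and c: "c \<noteq> 0"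
    and b: "summable b" "\<And>k. b k \<ge> 0"
  shows "\<exists>k. Re (c * u ^ k) < - b k"
proof (rule ccontr)
  assume "\<not> ?thesis"
  then have x: "Re (c * u ^ k) \<ge> - b k" for k by (auto simp: not_less)
  let ?x = "\<lambda>k. Re (c * u ^ k)"
  have geo: "norm (\<Sum>k<N. d * w ^ k) \<le> norm d * 2 / norm (w - 1)"
    if "norm w = 1" "w \<noteq> 1" for w d :: complex and N
  proof -
    have "(\<Sum>k<N. d * w ^ k) = d * ((w ^ N - 1) / (w - 1))"
      using that by (simp add: sum_distrib_left[symmetric] geometric_sum)
    moreover have "norm (w ^ N - 1) \<le> 2"
      using norm_triangle_ineq4[of "w ^ N" 1] that by (simp add: norm_power)
    ultimately show ?thesis
      by (simp add: norm_mult norm_divide divide_right_mono mult_left_mono)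
  qed
  define B1 where "B1 = norm c * 2 / norm (u - 1)"
  define B2 where "B2 = norm (c\<^sup>2) * 2 / norm (u\<^sup>2 - 1)"
  have u2: "norm (u\<^sup>2) = 1" "u\<^sup>2 \<noteq> 1"
    using u by (auto simp: norm_power power2_eq_1_iff)
  have bound: "real N * (norm c)\<^sup>2 \<le> 2 * norm c * (B1 + 2 * suminf b) + B2" for N
  proof -
    have "norm (\<Sum>k<N. c * u ^ k) \<le> B1" unfolding B1_def by (rule geo) (use u in auto)
    then have s1: "(\<Sum>k<N. ?x k) \<le> B1"
      using complex_Re_le_cmod[of "\<Sum>k<N. c * u ^ k"] by simp
    have "norm (\<Sum>k<N. c\<^sup>2 * (u\<^sup>2) ^ k) \<le> B2" unfolding B2_def by (rule geo) (use u2 in auto)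
    then have s2: "(\<Sum>k<N. Re (c\<^sup>2 * (u\<^sup>2) ^ k)) \<ge> - B2"
      using abs_Re_le_cmod[of "\<Sum>k<N. c\<^sup>2 * (u\<^sup>2) ^ k"] by simp
    \<comment> \<open>This yields the linear growth: the constant part sums to \<open>N\<close>
      times the squared norm of \<open>c\<close>, while the rest is a geometric sum with ratio
      \<open>u\<^sup>2\<close>, bounded because \<open>u\<close> is neither 1 nor -1.\<close>
    have sq: "2 * (?x k)\<^sup>2 = (norm c)\<^sup>2 + Re (c\<^sup>2 * (u\<^sup>2) ^ k)" for k
    proof -
      have gen: "2 * (Re z)\<^sup>2 = (norm z)\<^sup>2 + Re (z\<^sup>2)" for z
        unfolding cmod_power2 by (simp add: power2_eq_square)
      have "(c * u ^ k)\<^sup>2 = c\<^sup>2 * (u\<^sup>2) ^ k"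
        by (simp add: power_mult_distrib flip: power_mult) (simp add: mult.commute)
      moreover have "norm (c * u ^ k) = norm c" using u by (simp add: norm_mult norm_power)
      ultimately show ?thesis using gen[of "c * u ^ k"] by simp
    qed
    \<comment> \<open>From \<open>?x k \<ge> - b k\<close> the absolute value is at most
      \<open>?x k + 2 * b k\<close>, so the squares are controlled by the bounded sums of
      \<open>?x\<close> and of \<open>b\<close>.\<close>
    have sqle: "(?x k)\<^sup>2 \<le> norm c * (?x k + 2 * b k)" for k
    proof -
      have "\<bar>?x k\<bar> \<le> norm c"
        using abs_Re_le_cmod[of "c * u ^ k"] u by (simp add: norm_mult norm_power)
      then have "\<bar>?x k\<bar> * \<bar>?x k\<bar> \<le> norm c * \<bar>?x k\<bar>" by (rule mult_right_mono) simp
      also have "\<dots> \<le> norm c * (?x k + 2 * b k)"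
        using x[of k] b(2)[of k] by (intro mult_left_mono) auto
      finally show ?thesis by (simp add: power2_eq_square)
    qed
    have "real N * (norm c)\<^sup>2 - B2 \<le> (\<Sum>k<N. (norm c)\<^sup>2 + Re (c\<^sup>2 * (u\<^sup>2) ^ k))"
      using s2 by (simp add: sum.distrib)
    also have "\<dots> = (\<Sum>k<N. 2 * (?x k)\<^sup>2)" by (simp only: sq)
    also have "\<dots> \<le> (\<Sum>k<N. 2 * (norm c * (?x k + 2 * b k)))"
      using sqle by (intro sum_mono) simp
    also have "\<dots> = 2 * norm c * ((\<Sum>k<N. ?x k) + 2 * (\<Sum>k<N. b k))"
      by (simp only: sum_distrib_left[symmetric] sum.distrib mult.assoc)
    also have "\<dots> \<le> 2 * norm c * (B1 + 2 * suminf b)"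
      using s1 sum_le_suminf[OF b(1), of "{..<N}"] b(2) by (intro mult_left_mono) auto
    finally show ?thesis by simp
  qed
  have "(norm c)\<^sup>2 > 0" using c by simp
  from reals_Archimedean3[OF this] obtain N :: nat
    where "2 * norm c * (B1 + 2 * suminf b) + B2 < real N * (norm c)\<^sup>2" by blast
  then show False using bound[of N] by simp
qed

lemma sgn_not_real:
  fixes s :: complex
  assumes "Im s \<noteq> 0"
  shows "norm (sgn s) = 1" "sgn s \<noteq> 1" "sgn s \<noteq> -1"
proof -
  have "Im (sgn s) \<noteq> 0" using assms by (auto simp: Im_sgn)
  then show "sgn s \<noteq> 1" "sgn s \<noteq> -1" by force+
  show "norm (sgn s) = 1" using assms by (auto simp: norm_sgn)
qed

lemma Re_mult_power_sgn:
  "Re (c * s ^ k) = norm s ^ k * Re (c * sgn s ^ k)"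
proof -
  have "s = of_real (norm s) * sgn s" by (simp add: sgn_eq) 
  then have "c * s ^ k = of_real (norm s ^ k) * (c * sgn s ^ k)"
    by (metis mult.left_commute of_real_power power_mult_distrib)
  moreover have "Re (of_real r * w) = r * Re w" for r w by simp
  ultimately show ?thesis by metis
qed

lemma ex_Re_mult_power_nonneg:
  fixes c s :: complex
  assumes "Im s \<noteq> 0" "c \<noteq> 0"
  shows "\<exists>k. Re (c * s ^ k) \<ge> 0"
proof -
  obtain k where "Re (- c * sgn s ^ k) < - 0"
    using Re_mult_power_not_bounded_below[OF sgn_not_real[OF assms(1)], of "- c" "\<lambda>k. 0"] assms(2) by auto
  then have "Re (c * s ^ k) \<ge> 0" unfolding Re_mult_power_sgn[of c s k] by simp
  then show ?thesis by blast
qed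

lemma ex_Re_mult_power_less:
  fixes c s :: complex
  assumes "Im s \<noteq> 0" "norm s > 1" "c \<noteq> 0"
  shows "\<exists>k. Re (c * s ^ k) < M"
proof -
  \<comment> \<open>Chosen so that multiplying by \<open>norm s ^ k\<close> turns
    \<open>- b k\<close> into minus the absolute value of \<open>M\<close>; it is summable because
    \<open>norm s > 1\<close>.\<close>
  define b where "b k = \<bar>M\<bar> * (1 / norm s) ^ k" for k
  have "summable b" unfolding b_def using assms by (intro summable_mult summable_geometric) (auto simp: divide_less_eq)
  moreover have "b k \<ge> 0" for k by (simp add: b_def)
  ultimately obtain k where k: "Re (c * sgn s ^ k) < - b k"
    using Re_mult_power_not_bounded_below[OF sgn_not_real[OF assms(1)] assms(3)] by blast
  have "norm s > 0" using assms(2) by linarith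
  then have pos: "norm s ^ k > 0" by (rule zero_less_power)
  have "Re (c * s ^ k) < norm s ^ k * (- b k)"
    unfolding Re_mult_power_sgn[of c s k] using k pos by (rule mult_strict_left_mono)
  also have "\<dots> = - \<bar>M\<bar>" using \<open>norm s > 0\<close> by (simp add: b_def power_divide)
  finally show ?thesis by (intro exI[of _ k]) linarith
qed

text \<open>By the open mapping theorem the image contains a disc, which cannot lie in the real
  line.\<close>

lemma ex_not_real_value:
  assumes f: "f holomorphic_on ball z e" "\<not> f constant_on ball z e" and e: "e > 0"
  shows "\<exists>t\<in>ball z e. Im (f t) \<noteq> 0"
proof -
  have "open (f ` ball z e)" using open_mapping_thm[OF f(1) _ _ _ _ f(2)] by auto
  then obtain r where r: "r > 0" "cball (f z) r \<subseteq> f ` ball z e"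
    using e by (meson centre_in_ball image_eqI open_contains_cball)
  show "\<exists>t\<in>ball z e. Im (f t) \<noteq> 0"
  proof (rule ccontr)
    assume "\<not> ?thesis"
    then have "Im w = 0" if "w \<in> cball (f z) r" for w using r that by auto
    from this[of "f z"] this[of "f z + \<i> * of_real r"] r(1) show False by (simp add: dist_norm norm_mult)
  qed
qed

section \<open>Zeros of locally uniform limits\<close>

lemma uniform_limit_bounded_by_null:
  fixes f :: "nat \<Rightarrow> 'a \<Rightarrow> 'b :: real_normed_vector"
  assumes "\<And>n z. z \<in> K \<Longrightarrow> norm (f n z - g z) \<le> a n" "a \<longlonglongrightarrow> 0"
  shows "uniform_limit K f g sequentially"
proof (rule uniform_limitI)
  fix e :: real assume "e > 0"
  then have "\<forall>\<^sub>F n in sequentially. a n < e" using assms(2) order_tendstoD(2) by blast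
  then show "\<forall>\<^sub>F n in sequentially. \<forall>z\<in>K. dist (f n z) (g z) < e"
    by eventually_elim (use assms(1) in \<open>auto simp: dist_norm intro: le_less_trans\<close>)
qed

lemma compact_continuous_norm_bound:
  fixes f :: "'a :: topological_space \<Rightarrow> 'b :: real_normed_vector"
  assumes "compact K" "continuous_on K f"
  obtains B where "B \<ge> 0" "\<And>z. z \<in> K \<Longrightarrow> norm (f z) \<le> B"
proof -
  have "bounded (f ` K)" using assms compact_continuous_image compact_imp_bounded by blast
  then obtain B where "B > 0" "\<And>z. z \<in> K \<Longrightarrow> norm (f z) \<le> B" unfolding bounded_pos by auto
  then show ?thesis using that[of B] by auto
qed

lemma ex_zero_power_perturbation:
  fixes F H N \<delta> :: "complex \<Rightarrow> complex"
  assumes e: "e > 0" and hol: "F holomorphic_on ball z e" "H holomorphic_on ball z e"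
      "N holomorphic_on ball z e" "\<delta> holomorphic_on ball z e"
    and F: "\<And>t. t \<in> ball z e \<Longrightarrow> norm (F t) > 1"
    and H: "H z = 0" "\<not> H constant_on ball z e"
  shows "\<exists>l. \<exists>t\<in>ball z e. F t ^ l * H t + N t + of_nat l * \<delta> t = 0"
proof (rule ccontr)
  assume no: "\<not> ?thesis"
  \<comment> \<open>Division by \<open>F t ^ l\<close> keeps the zeros. On compact sets
    \<open>norm F\<close> is bounded below by some \<open>q > 1\<close>, which beats the linear
    growth in \<open>l\<close>, so \<open>f l\<close> tends to \<open>H\<close> and Hurwitz' theorem
    contradicts \<open>H z = 0\<close>.\<close>
  define f where "f l t = H t + (N t + of_nat l * \<delta> t) / F t ^ l" for l :: nat and t
  have F0: "F t \<noteq> 0" if "t \<in> ball z e" for t using F[OF that] by auto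
  have "H z \<noteq> 0"
  proof (rule Hurwitz_no_zeros[of "ball z e" f H])
    show "f l holomorphic_on ball z e" for l
      unfolding f_def using hol F0 by (intro holomorphic_intros) auto
    show "f l t \<noteq> 0" if "t \<in> ball z e" for l t
    proof
      assume "f l t = 0"
      then have "F t ^ l * H t + N t + of_nat l * \<delta> t = 0"
        using F0[OF that] by (simp add: f_def field_simps)
      then show False using no that by blast
    qed
    fix K assume K: "compact K" "K \<subseteq> ball z e"
    have cont: "continuous_on K F" "continuous_on K N" "continuous_on K \<delta>"
      using hol K(2) holomorphic_on_imp_continuous_on continuous_on_subset by blast+
    obtain A where A: "A \<ge> 0" "\<And>t. t \<in> K \<Longrightarrow> norm (N t) \<le> A"
      using compact_continuous_norm_bound[OF K(1) cont(2)] by blast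
    obtain B where B: "B \<ge> 0" "\<And>t. t \<in> K \<Longrightarrow> norm (\<delta> t) \<le> B"
      using compact_continuous_norm_bound[OF K(1) cont(3)] by blast
    obtain q where q: "q > 1" "\<And>t. t \<in> K \<Longrightarrow> norm (F t) \<ge> q"
    proof (cases "K = {}")
      case True
      then show ?thesis using that[of 2] by auto
    next
      case False
      have "continuous_on K (\<lambda>t. norm (F t))" using cont(1) by (intro continuous_intros)
      then obtain t where "t \<in> K" "\<And>s. s \<in> K \<Longrightarrow> norm (F t) \<le> norm (F s)"
        using continuous_attains_inf[OF K(1) False] by blast
      then show ?thesis using that[of "norm (F t)"] F K(2) by auto
    qed
    show "uniform_limit K f H sequentially"
    proof (rule uniform_limit_bounded_by_null)
      fix l t assume t: "t \<in> K"
      have "norm (f l t - H t) = norm (N t + of_nat l * \<delta> t) / norm (F t) ^ l"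
        by (simp add: f_def norm_divide norm_power)
      also have "\<dots> \<le> (A + real l * B) / q ^ l"
      proof (rule frac_le)
        have "norm (N t + of_nat l * \<delta> t) \<le> norm (N t) + norm (of_nat l * \<delta> t)" by (rule norm_triangle_ineq)
        also have "\<dots> \<le> A + real l * B"
          using A(2)[OF t] B(2)[OF t] by (simp add: norm_mult add_mono mult_left_mono)
        finally show "norm (N t + of_nat l * \<delta> t) \<le> A + real l * B" .
      qed (use A B q t in \<open>auto intro: power_mono\<close>)
      finally show "norm (f l t - H t) \<le> A * (1 / q) ^ l + B * (real l * (1 / q) ^ l)"
        by (simp add: add_divide_distrib power_divide mult.commute)
    next
      have "(\<lambda>l. (1 / q) ^ l) \<longlonglongrightarrow> 0" "(\<lambda>l. real l * (1 / q) ^ l) \<longlonglongrightarrow> 0"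
        using q by (auto intro!: LIMSEQ_power_zero powser_times_n_limit_0)
      then have "(\<lambda>l. A * (1 / q) ^ l + B * (real l * (1 / q) ^ l)) \<longlonglongrightarrow> A * 0 + B * 0"
        by (intro tendsto_add tendsto_mult tendsto_const)
      then show "(\<lambda>l. A * (1 / q) ^ l + B * (real l * (1 / q) ^ l)) \<longlonglongrightarrow> 0" by simp
    qed
  qed (use hol H e in auto)
  then show False using H by simp
qed

lemma floor_ratio_tendsto:
  assumes "\<And>n. \<bar>x * real (Suc n) - y n\<bar> \<le> 1"
  shows "(\<lambda>n. x - y n / real (Suc n)) \<longlonglongrightarrow> 0"
proof (rule Lim_null_comparison)
  show "\<forall>\<^sub>F n in sequentially. norm (x - y n / real (Suc n)) \<le> inverse (real (Suc n))"
  proof (intro always_eventually allI)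
    fix n
    have "x - y n / real (Suc n) = (x * real (Suc n) - y n) / real (Suc n)"
      by (simp add: field_simps)
    then show "norm (x - y n / real (Suc n)) \<le> inverse (real (Suc n))"
      using assms[of n] by (simp add: abs_divide inverse_eq_divide divide_right_mono)
  qed
qed (rule LIMSEQ_inverse_real_of_nat)

lemma uniform_limit_null_mult:
  fixes f :: "'a :: topological_space \<Rightarrow> complex"
  assumes "compact K" "continuous_on K f" "a \<longlonglongrightarrow> (0 :: real)"
  shows "uniform_limit K (\<lambda>n z. of_real (a n) * f z) (\<lambda>z. 0) sequentially"
proof -
  obtain B where B: "B \<ge> 0" "\<And>z. z \<in> K \<Longrightarrow> norm (f z) \<le> B"
    using compact_continuous_norm_bound[OF assms(1,2)] by blast
  show ?thesis
  proof (rule uniform_limit_bounded_by_null)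
    show "norm (of_real (a n) * f z - 0) \<le> \<bar>a n\<bar> * B" if "z \<in> K" for n z
      using B that by (simp add: norm_mult mult_left_mono)
    have "(\<lambda>n. \<bar>a n\<bar> * B) \<longlonglongrightarrow> 0 * B"
      using assms(3) by (intro tendsto_mult tendsto_const) (simp add: tendsto_rabs_zero)
    then show "(\<lambda>n. \<bar>a n\<bar> * B) \<longlonglongrightarrow> 0" by simp
  qed
qed

text \<open>
  Taking logarithms, the equation \<open>R\<^sup>n = h F\<^sup>m\<close> reads \<open>ln R - (m/n) ln F - (ln h)/n - 2 \<pi> i j/n = 0\<close>.
  With \<open>m/n\<close> and \<open>j/n\<close> tending to suitable reals, the left-hand side converges to a function that
  vanishes at the centre of the ball, and Hurwitz' theorem provides solutions in the ball.
\<close>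

lemma ex_power_eq_mult_power:
  fixes R F h :: "complex \<Rightarrow> complex"
  assumes e: "e > 0"
    and hol: "R holomorphic_on ball z e" "F holomorphic_on ball z e" "h holomorphic_on ball z e"
    and nz: "\<And>t. t \<in> ball z e \<Longrightarrow> R t \<noteq> 0" "\<And>t. t \<in> ball z e \<Longrightarrow> F t \<noteq> 0"
      "\<And>t. t \<in> ball z e \<Longrightarrow> h t \<noteq> 0"
    and gt: "norm (R z) > 1" "norm (F z) > 1"
    and indep: "\<And>\<mu> :: real. \<mu> > 0 \<Longrightarrow>
      \<exists>t\<in>ball z e. deriv R t * F t \<noteq> of_real \<mu> * deriv F t * R t"
  shows "\<exists>m n. \<exists>t\<in>ball z e. R t ^ n = h t * F t ^ m"
proof (rule ccontr)
  assume no: "\<not> ?thesis"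
  let ?B = "ball z e"
  have zB: "z \<in> ?B" using e by simp
  obtain G where G: "G holomorphic_on ?B" "\<And>t. t \<in> ?B \<Longrightarrow> exp (G t) = R t"
    using holomorphic_logarithm_exists[OF convex_ball open_ball hol(1) nz(1) zB] by blast
  obtain S where S: "S holomorphic_on ?B" "\<And>t. t \<in> ?B \<Longrightarrow> exp (S t) = F t"
    using holomorphic_logarithm_exists[OF convex_ball open_ball hol(2) nz(2) zB] by blast
  obtain L where L: "L holomorphic_on ?B" "\<And>t. t \<in> ?B \<Longrightarrow> exp (L t) = h t"
    using holomorphic_logarithm_exists[OF convex_ball open_ball hol(3) nz(3) zB] by blast
  have "exp (Re (G z)) > 1" "exp (Re (S z)) > 1"
    using gt G(2)[OF zB] S(2)[OF zB] by (metis norm_exp_eq_Re)+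
  then have pos: "Re (G z) > 0" "Re (S z) > 0" by simp_all
  \<comment> \<open>\<open>\<mu>\<close> makes the real part of \<open>G - \<mu> S\<close> vanish at
    \<open>z\<close>, and \<open>\<theta>\<close> removes its imaginary part; they are the limits of
    \<open>m/n\<close> and \<open>j/n\<close>.\<close>
  define \<mu> where "\<mu> = Re (G z) / Re (S z)"
  define \<theta> where "\<theta> = Im (G z - of_real \<mu> * S z) / (2 * pi)"
  have lam: "\<mu> > 0" using pos by (simp add: \<mu>_def)
  define g where "g t = G t - of_real \<mu> * S t - 2 * of_real pi * \<i> * of_real \<theta>" for t
  have "Re (g z) = 0" using pos by (simp add: g_def \<mu>_def)
  moreover have "Im (g z) = 0" by (simp add: g_def \<theta>_def)
  ultimately have gz: "g z = 0" by (simp add: complex_eq_iff)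
  define m where "m n = nat \<lfloor>\<mu> * real (Suc n)\<rfloor>" for n
  define j where "j n = \<lfloor>\<theta> * real (Suc n)\<rfloor>" for n
  define a where "a n = \<mu> - real (m n) / real (Suc n)" for n
  define b where "b n = inverse (real (Suc n))" for n
  define c where "c n = \<theta> - real_of_int (j n) / real (Suc n)" for n
  have a0: "a \<longlonglongrightarrow> 0" unfolding a_def
  proof (rule floor_ratio_tendsto)
    fix n
    have "\<mu> * real (Suc n) \<ge> 0" using lam by simp
    then have "real (m n) = of_int \<lfloor>\<mu> * real (Suc n)\<rfloor>" by (simp add: m_def)
    then show "\<bar>\<mu> * real (Suc n) - real (m n)\<bar> \<le> 1" by linarith
  qed
  have b0: "b \<longlonglongrightarrow> 0" unfolding b_def by (rule LIMSEQ_inverse_real_of_nat)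
  have c0: "c \<longlonglongrightarrow> 0" unfolding c_def
    by (rule floor_ratio_tendsto) (simp add: j_def, linarith)
  \<comment> \<open>The logarithmic form of the equation with exponents \<open>Suc n\<close> and
    \<open>m n\<close>, written as \<open>g\<close> plus terms whose scalar factors tend to
    0.\<close>
  define f where "f n t = g t + of_real (a n) * S t + of_real (b n) * (- L t)
    + of_real (c n) * (2 * of_real pi * \<i>)" for n t
  have "g z \<noteq> 0"
  proof (rule Hurwitz_no_zeros[of ?B f g])
    have holg: "g holomorphic_on ?B" unfolding g_def using G S by (intro holomorphic_intros)
    then show "g holomorphic_on ?B" .
    show "f n holomorphic_on ?B" for n unfolding f_def using holg S L by (intro holomorphic_intros)
    show "uniform_limit K f g sequentially" if K: "compact K" "K \<subseteq> ?B" for K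
    proof -
      have cont: "continuous_on K S" "continuous_on K (\<lambda>t. - L t)"
        using S L K(2) holomorphic_on_imp_continuous_on continuous_on_subset
        by (blast intro: continuous_on_minus)+
      have "uniform_limit K f (\<lambda>t. g t + 0 + 0 + 0) sequentially"
        unfolding f_def
        by (intro uniform_limit_add uniform_limit_const uniform_limit_null_mult K cont a0 b0 c0
            continuous_on_const)
      then show ?thesis by simp
    qed
    \<comment> \<open>If \<open>g\<close> were constant, the logarithmic derivative of
      \<open>R\<close> would be \<open>\<mu>\<close> times that of \<open>F\<close> on the whole
      ball, against \<open>indep\<close>.\<close>
    show "\<not> g constant_on ?B"
    proof
      assume "g constant_on ?B"
      then obtain d where d: "\<And>t. t \<in> ?B \<Longrightarrow> g t = d" by (auto simp: constant_on_def)
      obtain t where t: "t \<in> ?B" "deriv R t * F t \<noteq> of_real \<mu> * deriv F t * R t"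
        using indep[OF lam] by blast
      have ev: "\<forall>\<^sub>F s in nhds t. s \<in> ?B" using t(1) eventually_nhds_in_open[OF open_ball] by blast
      have dG: "(G has_field_derivative deriv G t) (at t)" "(S has_field_derivative deriv S t) (at t)"
        using G(1) S(1) t(1) holomorphic_derivI open_ball by blast+
      have "((\<lambda>s. exp (G s)) has_field_derivative exp (G t) * deriv G t) (at t)"
        "((\<lambda>s. exp (S s)) has_field_derivative exp (S t) * deriv S t) (at t)"
        using dG by (auto intro!: derivative_eq_intros)
      moreover have "deriv (\<lambda>s. exp (G s)) t = deriv R t"
        by (rule deriv_cong_ev[OF eventually_mono[OF ev] refl]) (rule G(2))
      moreover have "deriv (\<lambda>s. exp (S s)) t = deriv F t"
        by (rule deriv_cong_ev[OF eventually_mono[OF ev] refl]) (rule S(2))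
      ultimately have dR: "deriv R t = R t * deriv G t" and dF: "deriv F t = F t * deriv S t"
        using G(2)[OF t(1)] S(2)[OF t(1)] by (metis DERIV_imp_deriv)+
      have "(g has_field_derivative deriv G t - of_real \<mu> * deriv S t) (at t)"
        unfolding g_def using dG by (auto intro!: derivative_eq_intros)
      moreover have "(g has_field_derivative 0) (at t)"
        by (rule has_field_derivative_transform_within_open[OF DERIV_const open_ball t(1)]) (simp add: d)
      ultimately have "deriv G t = of_real \<mu> * deriv S t"
        by (metis DERIV_unique eq_iff_diff_eq_0)
      then show False using t(2) dR dF by (simp add: algebra_simps)
    qed
    show "f n t \<noteq> 0" if t: "t \<in> ?B" for n t
    proof
      assume f0: "f n t = 0"
      let ?n = "of_nat (Suc n) :: complex"
      have n0: "?n \<noteq> 0" by (simp del: of_nat_Suc)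
      have "f n t = G t - of_nat (m n) / ?n * S t - L t / ?n - 2 * of_real pi * \<i> * of_int (j n) / ?n"
        by (simp add: f_def g_def a_def b_def c_def algebra_simps divide_inverse del: of_nat_Suc)
      then have "?n * f n t = ?n * G t - of_nat (m n) * S t - L t - 2 * of_real pi * \<i> * of_int (j n)"
        using n0 by (simp add: right_diff_distrib del: of_nat_Suc)
      then have "?n * G t = of_nat (m n) * S t + L t + 2 * of_real pi * \<i> * of_int (j n)"
        unfolding f0 by (simp add: algebra_simps del: of_nat_Suc)
      then have "exp (?n * G t) = exp (of_nat (m n) * S t) * exp (L t) * exp (2 * of_real pi * \<i> * of_int (j n))"
        by (simp add: exp_add)
      moreover have "exp (2 * of_real pi * \<i> * of_int (j n)) = (1 :: complex)"
        using exp_integer_2pi[OF Ints_of_int[of "j n"]] by (simp add: mult_ac)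
      ultimately have "R t ^ Suc n = F t ^ m n * h t"
        unfolding exp_of_nat_mult using G(2) S(2) L(2) t by simp
      then show False using no t by (metis mult.commute)
    qed
  qed (use zB in auto)
  then show False using gz by simp
qed

subsection \<open>Density of the zeros\<close>

lemma not_constant_on_ball:
  assumes "f holomorphic_on UNIV" "f a \<noteq> f b" "e > 0"
  shows "\<not> f constant_on ball z e"
proof
  assume "f constant_on ball z e"
  then obtain c where c: "\<And>t. t \<in> ball z e \<Longrightarrow> f t = c" by (auto simp: constant_on_def)
  have "f t = c" for t
    by (rule analytic_continuation_open[of "ball z e" UNIV f "\<lambda>_. c"]) (use assms c in auto)
  then show False using assms(2) by simp
qed

lemma holomorphic_gf:
  "star_gf K holomorphic_on A" "num_gf K k holomorphic_on A" "den_gf K k holomorphic_on A"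
  "core_gf K k m n holomorphic_on A"
proof -
  show star: "star_gf K holomorphic_on A" unfolding star_gf_def by (intro holomorphic_intros)
  show num: "num_gf K k holomorphic_on A" unfolding num_gf_def using star by (intro holomorphic_intros)
  show den: "den_gf K k holomorphic_on A" unfolding den_gf_def using star by (intro holomorphic_intros)
  show "core_gf K k m n holomorphic_on A"
    unfolding core_gf_def using star num den by (intro holomorphic_intros)
qed

lemma star_gf_not_constant: "e > 0 \<Longrightarrow> \<not> star_gf K constant_on ball z e"
  by (rule not_constant_on_ball[OF holomorphic_gf(1), of K 0 1]) (simp_all add: star_gf_def)

lemma core_gf_not_constant: "e > 0 \<Longrightarrow> \<not> core_gf K k m n constant_on ball z e"
proof (rule not_constant_on_ball[OF holomorphic_gf(4), of K k m n 0 1])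
  \<comment> \<open>The value at 0 is 0, whereas at 1 every quantity is a positive natural
    number.\<close>
  let ?f = "1 + 2 ^ K :: nat"
  have "star_gf K 1 = of_nat ?f" by (simp add: star_gf_def)
  then have "core_gf K k m n 1 =
      of_nat ((1 + ?f ^ k + ?f ^ k) ^ n + ?f ^ m * ((1 + ?f ^ k) * 2) ^ n)"
    by (simp add: core_gf_def num_gf_def den_gf_def add_ac)
  also have "\<dots> \<noteq> 0" unfolding of_nat_eq_0_iff by simp
  finally show "core_gf K k m n 0 \<noteq> core_gf K k m n 1" by (simp add: core_gf_def)
qed

lemma norm_one_plus_gt_1:
  fixes w :: complex
  assumes "Re w \<ge> 0" "w \<noteq> 0"
  shows "norm (1 + w) > 1"
proof -
  have "(norm (1 + w))\<^sup>2 = 1 + 2 * Re w + (norm w)\<^sup>2"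
    unfolding cmod_power2 by (simp add: power2_eq_square algebra_simps)
  moreover have "(norm w)\<^sup>2 > 0" using assms by simp
  ultimately have "1\<^sup>2 < (norm (1 + w))\<^sup>2" using assms(1) unfolding one_power2 by linarith
  then show ?thesis by (rule power2_less_imp_less) simp
qed

text \<open>For a non-real \<open>s\<close> some \<open>K\<close> gives
  \<open>s * (1 + s) ^ K\<close> a nonnegative real part, hence
  \<open>norm (star_gf K s) > 1\<close>. This persists near \<open>s\<close>, where a non-real value
  of \<open>star_gf K\<close> is then found.\<close>

lemma ex_star_gf_large:
  assumes "e > 0"
  shows "\<exists>t\<in>ball z e. \<exists>K. Im t \<noteq> 0 \<and> norm (star_gf K t) > 1 \<and> Im (star_gf K t) \<noteq> 0"
proof -
  have "\<exists>t\<in>ball z e. Im t \<noteq> 0"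
    using assms by (intro ex_not_real_value not_constant_on_ball[of "\<lambda>t. t" 0 1])
      (auto intro: holomorphic_intros)
  then obtain s where s: "s \<in> ball z e" "Im s \<noteq> 0" by blast
  obtain K where "Re (s * (1 + s) ^ K) \<ge> 0"
    using ex_Re_mult_power_nonneg[of "1 + s" s] s(2) by (force simp del: times_complex.sel)
  moreover have "s \<noteq> 0" "1 + s \<noteq> 0" using s(2) by (auto simp: complex_eq_iff)
  ultimately have K: "norm (star_gf K s) > 1"
    unfolding star_gf_def by (intro norm_one_plus_gt_1) auto
  have cont: "continuous_on UNIV (star_gf K)"
    using holomorphic_gf(1) by (rule holomorphic_on_imp_continuous_on)
  let ?U = "ball z e \<inter> {t. Im t \<noteq> 0} \<inter> {t. norm (star_gf K t) > 1}"
  have "open ?U"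
    by (intro open_Int open_ball open_Collect_neq open_Collect_less continuous_intros cont)
  moreover have "s \<in> ?U" using s K by simp
  ultimately obtain r where r: "r > 0" "ball s r \<subseteq> ?U" by (rule openE)
  obtain t where "t \<in> ball s r" "Im (star_gf K t) \<noteq> 0"
    using ex_not_real_value[OF holomorphic_gf(1) star_gf_not_constant r(1)] r(1) by blast
  then show ?thesis using r by blast
qed

text \<open>With \<open>w = D / t\<close> the ratio is \<open>1 - 1 / w\<close>, which has norm
  above 1 as soon as \<open>Re w < 0\<close>; the powers of the non-real \<open>star_gf K t\<close>
  of norm above 1 push \<open>Re w\<close> below any bound.\<close>

lemma ex_ratio_large:
  assumes t: "Im t \<noteq> 0" and F: "norm (star_gf K t) > 1" "Im (star_gf K t) \<noteq> 0"
  shows "\<exists>k. den_gf K k t \<noteq> 0 \<and> norm (num_gf K k t / den_gf K k t) > 1"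
proof -
  have t0: "t \<noteq> 0" "1 + t \<noteq> 0" using t by (auto simp: complex_eq_iff)
  obtain k where k: "Re ((1 + t) * star_gf K t ^ k) < - Re (1 + 1 / t)"
    using ex_Re_mult_power_less[OF F(2,1) t0(2)] by blast
  define w where "w = den_gf K k t / t"
  have w: "w = 1 + 1 / t + (1 + t) * star_gf K t ^ k"
    using t0 by (simp add: w_def den_gf_def field_simps)
  have "Re w < 0" unfolding w using k by simp
  then have w0: "w \<noteq> 0" "den_gf K k t \<noteq> 0" by (auto simp: w_def)
  have "num_gf K k t = den_gf K k t - t" by (simp add: num_gf_def den_gf_def algebra_simps)
  then have "num_gf K k t / den_gf K k t = 1 + - inverse w"
    using w0 t0 by (simp add: w_def field_simps)
  moreover have "norm (1 + - inverse w) > 1"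
  proof (rule norm_one_plus_gt_1)
    show "Re (- inverse w) \<ge> 0"
      using \<open>Re w < 0\<close> by (simp add: divide_nonpos_nonneg)
  qed (use w0 in simp)
  ultimately show ?thesis using w0 by metis
qed

lemma deriv_gf_0:
  "deriv (star_gf K) 0 = 1" "deriv (num_gf K k) 0 = 1" "deriv (den_gf K k) 0 = 2"
proof -
  have s: "(star_gf K has_field_derivative 1) (at 0)"
    unfolding star_gf_def by (auto intro!: derivative_eq_intros)
  then show "deriv (star_gf K) 0 = 1" by (rule DERIV_imp_deriv)
  have "star_gf K 0 = 1" by (simp add: star_gf_def)
  with s show "deriv (num_gf K k) 0 = 1" "deriv (den_gf K k) 0 = 2"
    unfolding num_gf_def den_gf_def by (auto intro!: DERIV_imp_deriv derivative_eq_intros)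
qed

text \<open>
  A multiplicative dependence between the ratio and a positive power of \<open>star_gf\<close> would persist at
  the origin, where their logarithmic derivatives are \<open>-1\<close> and \<open>1\<close>.
\<close>

lemma ratio_star_gf_independent:
  assumes e: "e > 0" and den: "\<And>t. t \<in> ball z e \<Longrightarrow> den_gf K k t \<noteq> 0" and "\<mu> > (0 :: real)"
  shows "\<exists>t\<in>ball z e. deriv (\<lambda>t. num_gf K k t / den_gf K k t) t * star_gf K t \<noteq>
    of_real \<mu> * deriv (star_gf K) t * (num_gf K k t / den_gf K k t)"
proof (rule ccontr)
  assume no: "\<not> ?thesis"
  let ?n = "num_gf K k" and ?d = "den_gf K k" and ?f = "star_gf K"
  let ?L = "\<lambda>t. (deriv ?n t * ?d t - ?n t * deriv ?d t) * ?f t"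
  let ?R = "\<lambda>t. of_real \<mu> * deriv ?f t * ?n t * ?d t"
  have "?L 0 = ?R 0"
  \<comment> \<open>With denominators cleared both sides are entire, so the identity extends from
    the ball to 0 regardless of zeros of \<open>den_gf\<close> elsewhere.\<close>
  proof (rule analytic_continuation_open[of "ball z e" UNIV ?L ?R])
    show "?L holomorphic_on UNIV" "?R holomorphic_on UNIV"
      by (intro holomorphic_intros holomorphic_deriv holomorphic_gf open_UNIV)+
    fix t assume t: "t \<in> ball z e"
    have "(?n has_field_derivative deriv ?n t) (at t)" "(?d has_field_derivative deriv ?d t) (at t)"
      by (rule holomorphic_derivI[OF holomorphic_gf(2) open_UNIV UNIV_I]
          holomorphic_derivI[OF holomorphic_gf(3) open_UNIV UNIV_I])+
    then have "((\<lambda>t. ?n t / ?d t) has_field_derivative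
        (deriv ?n t * ?d t - ?n t * deriv ?d t) / (?d t * ?d t)) (at t)"
      using den[OF t] by (rule DERIV_divide)
    from DERIV_imp_deriv[OF this] no t
    have "(deriv ?n t * ?d t - ?n t * deriv ?d t) / (?d t * ?d t) * ?f t =
        of_real \<mu> * deriv ?f t * (?n t / ?d t)" by metis
    then have "?L t / (?d t * ?d t) = ?R t / (?d t * ?d t)" using den[OF t] by simp
    then show "?L t = ?R t" using den[OF t] by (simp only: divide_cancel_right mult_eq_0_iff) simp
  qed (use e in auto)
  moreover have "?n 0 = 1" "?d 0 = 1" "?f 0 = 1"
    by (simp_all add: num_gf_def den_gf_def star_gf_def)
  ultimately have "of_real \<mu> = (-1 :: complex)" by (simp add: deriv_gf_0)
  then have "\<mu> = -1" by (metis of_real_1 of_real_eq_iff of_real_minus)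
  with assms(3) show False by simp
qed

lemma ex_connected_gf_zero:
  assumes "e > 0"
  shows "\<exists>t\<in>ball z e. \<exists>G :: nat pair_pre_digraph.
    pair_graph G \<and> pverts G \<noteq> {} \<and> connected_gf G t = 0"
proof -
  obtain s K where s: "s \<in> ball z e" and t: "Im s \<noteq> 0"
    and F: "norm (star_gf K s) > 1" "Im (star_gf K s) \<noteq> 0"
    using ex_star_gf_large[OF assms] by blast
  obtain k where d: "den_gf K k s \<noteq> 0" and ratio: "norm (num_gf K k s / den_gf K k s) > 1"
    using ex_ratio_large[OF t F] by blast
  then have n: "num_gf K k s \<noteq> 0" by auto
  have s0: "s \<noteq> 0" using t by auto
  have cont: "continuous_on UNIV (star_gf K)" "continuous_on UNIV (num_gf K k)" "continuous_on UNIV (den_gf K k)"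
    by (intro holomorphic_on_imp_continuous_on holomorphic_gf)+
  let ?U = "ball z e \<inter> {t. norm (star_gf K t) > 1} \<inter> {t. num_gf K k t \<noteq> 0} \<inter> {t. den_gf K k t \<noteq> 0} \<inter> {t. t \<noteq> 0}"
  have U: "open ?U"
    by (intro open_Int open_ball open_Collect_neq open_Collect_less continuous_intros cont)
  moreover have "s \<in> ?U" using s F d n s0 by simp
  ultimately obtain r where r: "r > 0" "ball s r \<subseteq> ?U" by (rule openE)
  \<comment> \<open>Where \<open>t\<close> and \<open>den_gf K k t\<close> are nonzero, this
    equation says exactly that \<open>core_gf K k m n t = 0\<close>.\<close>
  have "\<exists>m n. \<exists>t\<in>ball s r. (num_gf K k t / den_gf K k t) ^ n = - t * star_gf K t ^ m"
  proof (rule ex_power_eq_mult_power[OF r(1)])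
    show "(\<lambda>t. num_gf K k t / den_gf K k t) holomorphic_on ball s r"
      using r by (intro holomorphic_intros holomorphic_gf) auto
    show "\<exists>t\<in>ball s r. deriv (\<lambda>t. num_gf K k t / den_gf K k t) t * star_gf K t \<noteq>
        of_real \<mu> * deriv (star_gf K) t * (num_gf K k t / den_gf K k t)" if "\<mu> > 0" for \<mu>
      using r that by (intro ratio_star_gf_independent) auto
    fix t assume "t \<in> ball s r"
    then have "t \<in> ?U" using r(2) by blast
    then show "star_gf K t \<noteq> 0" "- t \<noteq> 0" "num_gf K k t / den_gf K k t \<noteq> 0" by auto
  qed (intro ratio F(1) holomorphic_gf holomorphic_intros)+
  then obtain m n w where w: "w \<in> ball s r"
    and eq: "(num_gf K k w / den_gf K k w) ^ n = - w * star_gf K w ^ m" by blast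
  have "den_gf K k w \<noteq> 0" using w r by auto
  then have "num_gf K k w ^ n = - w * star_gf K w ^ m * den_gf K k w ^ n"
    using eq by (simp add: power_divide field_simps)
  then have core: "core_gf K k m n w = 0" by (simp add: core_gf_def)
  have "w \<in> ?U" using w r by blast
  with U obtain q where q: "q > 0" "ball w q \<subseteq> ?U" by (rule openE)
  obtain N \<delta> where hol: "N holomorphic_on UNIV" "\<delta> holomorphic_on UNIV"
    and fam: "\<And>l. \<exists>G :: nat pair_pre_digraph. pair_graph G \<and> pverts G \<noteq> {} \<and>
        (\<forall>t. connected_gf G t = star_gf K t ^ l * core_gf K k m n t + N t + of_nat l * \<delta> t)"
    using ex_graph_family[of K k m n] by blast
  have "\<exists>l. \<exists>t\<in>ball w q. star_gf K t ^ l * core_gf K k m n t + N t + of_nat l * \<delta> t = 0"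
    using q hol core
    by (intro ex_zero_power_perturbation holomorphic_gf core_gf_not_constant)
      (auto intro: holomorphic_on_subset)
  then obtain l t where t: "t \<in> ball w q"
    "star_gf K t ^ l * core_gf K k m n t + N t + of_nat l * \<delta> t = 0" by blast
  then have "t \<in> ball z e" using q by blast
  moreover obtain G :: "nat pair_pre_digraph" where "pair_graph G" "pverts G \<noteq> {}"
    "\<forall>t. connected_gf G t = star_gf K t ^ l * core_gf K k m n t + N t + of_nat l * \<delta> t"
    using fam[of l] by blast
  ultimately show ?thesis using t(2) by (intro bexI[of _ t] exI[of _ G] conjI) simp_all
qed

theorem theorem5:
  shows "closure {z :: complex. \<exists>G :: nat pair_pre_digraph.
           pair_graph G \<and> pverts G \<noteq> {} \<and> poly (NRel G) z = 0} = UNIV"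
proof -
  let ?Z = "{z :: complex. \<exists>G :: nat pair_pre_digraph.
           pair_graph G \<and> pverts G \<noteq> {} \<and> poly (NRel G) z = 0}"
  let ?h = "\<lambda>t :: complex. t / (1 + t)"
  have zero: "?h t \<in> ?Z"
    if "pair_graph G" "pverts G \<noteq> {}" "connected_gf G t = 0" "t \<noteq> -1"
    for t and G :: "nat pair_pre_digraph"
  proof -
    have t: "1 + t \<noteq> 0" using that(4) by (metis add.commute add_eq_0_iff)
    then have "?h t \<noteq> 1" "?h t / (1 - ?h t) = t" by (auto simp: field_simps)
    then have "poly (NRel G) (?h t) = 0" using that poly_NRel[of G "?h t"] by simp
    then show ?thesis using that by blast
  qed
  have "p \<in> closure ?Z" if p: "p \<noteq> 1" for p
  proof -
    define s where "s = p / (1 - p)"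
    have s: "1 + s \<noteq> 0" "?h s = p" using p by (auto simp: s_def field_simps)
    have cont: "isCont ?h s" using s by (intro continuous_intros) auto
    have "\<exists>y\<in>?Z. dist y p < \<epsilon>" if "\<epsilon> > 0" for \<epsilon>
    proof -
      from cont[unfolded continuous_at_eps_delta s(2), rule_format, OF that]
      obtain d where d: "d > 0" "\<And>t. dist t s < d \<Longrightarrow> dist (?h t) p < \<epsilon>" by auto
      \<comment> \<open>The second bound keeps \<open>t\<close> away from -1, the point that
        corresponds to no finite \<open>p\<close>.\<close>
      have "min d (norm (1 + s)) > 0" using d s by simp
      from ex_connected_gf_zero[OF this, of s] obtain t and G :: "nat pair_pre_digraph"
        where t: "t \<in> ball s (min d (norm (1 + s)))"
          and G: "pair_graph G" "pverts G \<noteq> {}" "connected_gf G t = 0" by blast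
      have "t \<noteq> -1" using t by (auto simp: dist_norm add.commute)
      then have "?h t \<in> ?Z" by (rule zero[OF G])
      moreover have "dist (?h t) p < \<epsilon>" using t by (intro d(2)) (simp add: dist_commute)
      ultimately show ?thesis by (rule bexI[rotated])
    qed
    then show ?thesis by (simp only: closure_approachable) simp
  qed
  then have "UNIV - {1} \<subseteq> closure ?Z" by auto
  then have "closure (UNIV - {1}) \<subseteq> closure ?Z" by (intro closure_minimal) auto
  \<comment> \<open>The point 1 has no preimage under \<open>?h\<close>, but it is a limit of the
    points already covered.\<close>
  moreover have "closure (UNIV - {1 :: complex}) = UNIV"
    by (simp add: closure_complement flip: Compl_eq_Diff_UNIV)
  ultimately show ?thesis by auto
qed

end
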